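(* Let $p$ be a prime and let $(u_n)_{n\ge 0}$ be the coefficients of the Artin-Hasse exponential $E(x)=\exp\left(\sum_{k=0}^\infty \frac{x^{p^k}}{p^k}\right)=\sum_{n=0}^\infty u_nx^n$, with $u_n=0$ for $n<0$. Then for every integer $\ell\ge 1$, the determinant of the $\ell\times\ell$ matrix whose $(i,j)$ entry is $u_{pi-j}$ is $$\left|u_{pi-j}\right|_{1\le i,j\le \ell}=\prod_{k=1}^{\ell}\frac{k!\,p^k}{(pk)!},$$ and this number lies in $\mathbb{Z}_p^\times$.
   Context: $p$ is a fixed prime. The Artin-Hasse exponential $E(x)$ is a power series with coefficients $u_n\in\mathbb{Z}_p\cap\mathbb{Q}$. The notation $|a_{i,j}|_{1\le i,j\le \ell}$ denotes the determinant of the matrix $(a_{i,j})_{1\le i,j\le\ell}$. $\mathbb{Z}_p^\times$ is the group of units of the $p$-adic integers $\mathbb{Z}_p$. *)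

theory Defs
  imports
    "Jordan_Normal_Form.Determinant"
    "HOL-Computational_Algebra.Formal_Power_Series"
    "HOL-Computational_Algebra.Primes"
    "HOL-Number_Theory.Cong"
begin

section \<open>The Artin-Hasse exponential\<close>

definition artin_hasse_log :: "nat \<Rightarrow> rat fps" where
  "artin_hasse_log p = Abs_fps (\<lambda>n. if \<exists>k. n = p ^ k then 1 / of_nat n else 0)"

lemma artin_hasse_log_sums:
  assumes "prime p"
  shows "(\<lambda>k. fps_const (1 / of_nat (p ^ k)) * fps_X ^ (p ^ k)) sums artin_hasse_log p"
  unfolding sums_def
proof (rule tendsto_fpsI)
  fix n :: nat
  from assms have p: "p > 1" by (rule prime_gt_1_nat)
  have "fps_nth (\<Sum>k<N. fps_const (1 / of_nat (p ^ k)) * fps_X ^ (p ^ k)) n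
      = fps_nth (artin_hasse_log p) n" if N: "N > n" for N
  proof -
    have nth: "fps_nth (\<Sum>k<N. fps_const (1 / of_nat (p ^ k)) * fps_X ^ (p ^ k)) n
        = (\<Sum>k<N. if n = p ^ k then 1 / rat_of_nat n else 0)"
      by (auto simp: fps_sum_nth fps_X_power_nth intro!: sum.cong)
    show ?thesis
    proof (cases "\<exists>k. n = p ^ k")
      case True
      then obtain k where k: "n = p ^ k" by blast
      have "k < p ^ k" using p by (intro power_gt_expt) simp
      with k N have kN: "k < N" by simp
      have "(\<Sum>i<N. if n = p ^ i then 1 / rat_of_nat n else 0)
          = (\<Sum>i<N. if i = k then 1 / rat_of_nat n else 0)"
        using p k by (intro sum.cong) auto
      also have "\<dots> = 1 / rat_of_nat n" using kN by simp
      finally show ?thesis using True nth by (simp add: artin_hasse_log_def)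
    next
      case False
      then show ?thesis using nth by (simp add: artin_hasse_log_def)
    qed
  qed
  then show "\<forall>\<^sub>F N in sequentially.
      fps_nth (\<Sum>k<N. fps_const (1 / of_nat (p ^ k)) * fps_X ^ (p ^ k)) n
      = fps_nth (artin_hasse_log p) n"
    unfolding eventually_at_top_dense by blast
qed

definition artin_hasse_exp :: "nat \<Rightarrow> rat fps" where
  "artin_hasse_exp p = fps_exp 1 oo artin_hasse_log p"

definition artin_hasse_coeff :: "nat \<Rightarrow> int \<Rightarrow> rat" where
  "artin_hasse_coeff p n = (if n < 0 then 0 else fps_nth (artin_hasse_exp p) (nat n))"


section \<open>The $p$-adic integers\<close>

text \<open>
  The inverse limit of the rings of integers modulo \<open>p ^ n\<close>: a \<open>p\<close>-adic integer is a
  coherent sequence of residues, each given by its representative in \<open>{0..<p ^ n}\<close>.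
\<close>

definition padic_ring :: "nat \<Rightarrow> (nat \<Rightarrow> int) ring" where
  "padic_ring p =
     \<lparr>carrier = {x. \<forall>n. x n \<in> {0..<int p ^ n} \<and> x (Suc n) mod int p ^ n = x n},
      monoid.mult = (\<lambda>x y n. (x n * y n) mod int p ^ n),
      one = (\<lambda>n. 1 mod int p ^ n),
      zero = (\<lambda>n. 0),
      add = (\<lambda>x y n. (x n + y n) mod int p ^ n)\<rparr>"

definition padic_of_int :: "nat \<Rightarrow> int \<Rightarrow> nat \<Rightarrow> int" where
  "padic_of_int p a = (\<lambda>n. a mod int p ^ n)"

text \<open>
  Inside the field of \<open>p\<close>-adic numbers, the rational number \<open>q = a / b\<close> equals the
  \<open>p\<close>-adic integer \<open>x\<close> iff \<open>b * x = a\<close>, an equation between \<open>p\<close>-adic integers.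
\<close>

definition rat_eq_padic :: "nat \<Rightarrow> rat \<Rightarrow> (nat \<Rightarrow> int) \<Rightarrow> bool" where
  "rat_eq_padic p q x \<longleftrightarrow> x \<in> carrier (padic_ring p) \<and>
     (case quotient_of q of (a, b) \<Rightarrow>
        padic_of_int p b \<otimes>\<^bsub>padic_ring p\<^esub> x = padic_of_int p a)"

definition padic_unit_rats :: "nat \<Rightarrow> rat set" where
  "padic_unit_rats p = {q. \<exists>x \<in> Units (padic_ring p). rat_eq_padic p q x}"

lemma cring_padic_ring:
  assumes "prime p"
  shows "cring (padic_ring p)"
proof -
  let ?P = "\<lambda>n. int p ^ n"
  have pos: "?P n > 0" for n using assms prime_gt_0_nat by simp
  have mm: "z mod (int p * ?P n) mod ?P n = z mod ?P n" for z n
    by (simp add: mod_mod_cancel)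
  have closed: "(\<lambda>n. f n mod ?P n) \<in> carrier (padic_ring p)"
    if "\<And>n. f (Suc n) mod ?P n = f n mod ?P n" for f
    using that pos by (simp add: padic_ring_def mm)
  have coh: "x (Suc n) mod ?P n = x n mod ?P n" if "x \<in> carrier (padic_ring p)" for x n
    using that by (simp add: padic_ring_def)
  have red: "x n mod ?P n = x n" if "x \<in> carrier (padic_ring p)" for x n
    using that by (simp add: padic_ring_def)
  have minus: "(\<lambda>n. (- x n) mod ?P n) \<in> carrier (padic_ring p)"
    if "x \<in> carrier (padic_ring p)" for x
    by (intro closed mod_minus_cong coh that)
  have add: "x \<oplus>\<^bsub>padic_ring p\<^esub> y \<in> carrier (padic_ring p)"
    if "x \<in> carrier (padic_ring p)" "y \<in> carrier (padic_ring p)" for x y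
  proof -
    have "(\<lambda>n. (x n + y n) mod ?P n) \<in> carrier (padic_ring p)"
      by (intro closed mod_add_cong coh that)
    then show ?thesis by (simp add: padic_ring_def)
  qed
  have mult: "x \<otimes>\<^bsub>padic_ring p\<^esub> y \<in> carrier (padic_ring p)"
    if "x \<in> carrier (padic_ring p)" "y \<in> carrier (padic_ring p)" for x y
  proof -
    have "(\<lambda>n. (x n * y n) mod ?P n) \<in> carrier (padic_ring p)"
      by (intro closed mod_mult_cong coh that)
    then show ?thesis by (simp add: padic_ring_def)
  qed
  have zero: "\<zero>\<^bsub>padic_ring p\<^esub> \<in> carrier (padic_ring p)"
    using pos by (simp add: padic_ring_def)
  have one: "\<one>\<^bsub>padic_ring p\<^esub> \<in> carrier (padic_ring p)"
    using closed[of "\<lambda>_. 1"] by (simp add: padic_ring_def)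
  have minus_add: "\<exists>y\<in>carrier (padic_ring p). y \<oplus>\<^bsub>padic_ring p\<^esub> x = \<zero>\<^bsub>padic_ring p\<^esub>"
    if "x \<in> carrier (padic_ring p)" for x
    using minus[OF that] by (intro bexI[of _ "\<lambda>n. (- x n) mod ?P n"])
      (simp_all add: padic_ring_def mod_simps)
  show ?thesis
  proof (intro cringI abelian_groupI comm_monoidI)
    fix x y z
    assume x: "x \<in> carrier (padic_ring p)"
    show "\<zero>\<^bsub>padic_ring p\<^esub> \<oplus>\<^bsub>padic_ring p\<^esub> x = x"
      using red[OF x] by (simp add: padic_ring_def)
    show "\<one>\<^bsub>padic_ring p\<^esub> \<otimes>\<^bsub>padic_ring p\<^esub> x = x"
      using red[OF x] by (simp add: padic_ring_def mod_simps)
    show "x \<oplus>\<^bsub>padic_ring p\<^esub> y = y \<oplus>\<^bsub>padic_ring p\<^esub> x"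
      by (simp add: padic_ring_def add.commute)
    show "x \<otimes>\<^bsub>padic_ring p\<^esub> y = y \<otimes>\<^bsub>padic_ring p\<^esub> x"
      by (simp add: padic_ring_def mult.commute)
    show "x \<oplus>\<^bsub>padic_ring p\<^esub> y \<oplus>\<^bsub>padic_ring p\<^esub> z = x \<oplus>\<^bsub>padic_ring p\<^esub> (y \<oplus>\<^bsub>padic_ring p\<^esub> z)"
      by (simp add: padic_ring_def mod_simps add.assoc)
    show "x \<otimes>\<^bsub>padic_ring p\<^esub> y \<otimes>\<^bsub>padic_ring p\<^esub> z = x \<otimes>\<^bsub>padic_ring p\<^esub> (y \<otimes>\<^bsub>padic_ring p\<^esub> z)"
      by (simp add: padic_ring_def mod_simps mult.assoc)
    show "(x \<oplus>\<^bsub>padic_ring p\<^esub> y) \<otimes>\<^bsub>padic_ring p\<^esub> z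
        = x \<otimes>\<^bsub>padic_ring p\<^esub> z \<oplus>\<^bsub>padic_ring p\<^esub> y \<otimes>\<^bsub>padic_ring p\<^esub> z"
      by (simp add: padic_ring_def mod_simps distrib_right)
  qed (use add mult zero one minus_add in blast)+
qed

lemma rat_eq_padic_unique:
  assumes "prime p" "rat_eq_padic p q x" "rat_eq_padic p q y"
  shows "x = y"
proof
  fix n
  obtain a b where q: "quotient_of q = (a, b)" by fastforce
  then have b: "b \<noteq> 0" using quotient_of_denom_pos by fastforce
  have p: "prime (int p)" using assms(1) by simp
  define v where "v = multiplicity (int p) b"
  obtain b' where b': "b = int p ^ v * b'" "\<not> int p dvd b'"
    using multiplicity_decompose'[of b "int p"] b p unfolding v_def
    by (metis not_prime_unit)
  have cop: "coprime (int p ^ n) b'"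
    using b'(2) p by (simp add: prime_imp_coprime)
  have down: "z (n + k) mod int p ^ n = z n" if "z \<in> carrier (padic_ring p)" for z k
  proof (induction k)
    case 0
    then show ?case using that by (simp add: padic_ring_def)
  next
    case (Suc k)
    have "z (Suc (n + k)) mod int p ^ (n + k) = z (n + k)"
      using that by (simp add: padic_ring_def)
    then have "z (n + k) mod int p ^ n = z (Suc (n + k)) mod int p ^ n"
      by (metis le_add1 le_imp_power_dvd mod_mod_cancel)
    then show ?case using Suc by simp
  qed
  have xy: "x \<in> carrier (padic_ring p)" "y \<in> carrier (padic_ring p)"
    using assms by (auto simp: rat_eq_padic_def)
  have "padic_of_int p b \<otimes>\<^bsub>padic_ring p\<^esub> x = padic_of_int p b \<otimes>\<^bsub>padic_ring p\<^esub> y"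
    using assms(2,3) q by (simp add: rat_eq_padic_def)
  then have "(b * x (n + v)) mod int p ^ (n + v) = (b * y (n + v)) mod int p ^ (n + v)"
    by (auto simp: padic_ring_def padic_of_int_def mod_simps dest: fun_cong[of _ _ "n + v"])
  then have "int p ^ (n + v) dvd b * (x (n + v) - y (n + v))"
    by (simp add: mod_eq_dvd_iff right_diff_distrib)
  then have "int p ^ v * int p ^ n dvd int p ^ v * (b' * (x (n + v) - y (n + v)))"
    by (simp add: b' power_add mult_ac)
  then have "int p ^ n dvd b' * (x (n + v) - y (n + v))"
    using p by (simp add: dvd_mult_cancel_left)
  then have "int p ^ n dvd x (n + v) - y (n + v)"
    using cop by (simp add: coprime_dvd_mult_right_iff)
  then show "x n = y n"
    using down[OF xy(1), of v] down[OF xy(2), of v] by (metis mod_eq_dvd_iff)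
qed

end

theory Submission
  imports Defs "HOL-Number_Theory.Modular_Inverse"
begin

text \<open>
  Write \<open>E(x) = e\<^sup>x G(x)\<close>. The logarithmic derivative of \<open>G\<close> is the sum of \<open>x ^ (p ^ k - 1)\<close> over
  \<open>k \<ge> 1\<close>, so \<open>G\<close> is a power series in \<open>x ^ p\<close>, and comparing coefficients shows that
  \<open>u (p a - b)\<close> is the sum of \<open>g (p (a - c)) / (p c - b)!\<close> over \<open>c \<ge> 1\<close>. Next,
  \<open>1 / (p c - b)! = (b! / (p c)!) (p c choose b)\<close>, and expanding
  \<open>(1 + x) ^ (p c) = (1 + ((1 + x) ^ p - 1)) ^ c\<close> writes \<open>p c choose b\<close> as the sum of
  \<open>(c choose k) [x ^ b] ((1 + x) ^ p - 1) ^ k\<close>. Hence the matrix is a product of two lower triangular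
  matrices and an upper triangular one, and their diagonals are \<open>1\<close>, \<open>1 / (p k)!\<close> and \<open>k! p ^ k\<close>.
  The reciprocal of the resulting product is an integer because \<open>(p k)! / (k! p ^ k)\<close> is the product
  of the numbers up to \<open>p k\<close> that are prime to \<open>p\<close>.
\<close>

section \<open>Removing the exponential factor\<close>

definition artin_hasse_reduced :: "nat \<Rightarrow> rat fps" where
  "artin_hasse_reduced p = artin_hasse_exp p * fps_exp (- 1)"

lemma artin_hasse_exp_eq: "artin_hasse_exp p = artin_hasse_reduced p * fps_exp 1"
proof -
  have "fps_exp (- 1) * fps_exp 1 = (1 :: rat fps)"
    using fps_exp_add_mult[of "- 1 :: rat" 1] by simp
  then show ?thesis
    by (simp add: artin_hasse_reduced_def mult.assoc)
qed

lemma artin_hasse_reduced_nth_0: "fps_nth (artin_hasse_reduced p) 0 = 1"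
  by (simp add: artin_hasse_reduced_def artin_hasse_exp_def)

text \<open>Product rule: the chain rule contributes the derivative of the logarithm, the factor
  \<open>fps_exp (- 1)\<close> contributes \<open>- 1\<close>.\<close>

lemma fps_deriv_artin_hasse_reduced:
  "fps_deriv (artin_hasse_reduced p)
     = artin_hasse_reduced p * (fps_deriv (artin_hasse_log p) - 1)"
proof -
  \<comment> \<open>Required by the chain rule for composition. Both branches of the definition give
    0 here, since \<open>1 / 0 = 0\<close>.\<close>
  have "fps_nth (artin_hasse_log p) 0 = 0"
    by (simp add: artin_hasse_log_def)
  then have "fps_deriv (artin_hasse_exp p) = artin_hasse_exp p * fps_deriv (artin_hasse_log p)"
    by (simp add: artin_hasse_exp_def fps_compose_deriv)
  moreover have "fps_const (- 1) = (- 1 :: rat fps)"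
    by (metis fps_const_1_eq_1 fps_const_neg)
  ultimately show ?thesis
    by (simp add: artin_hasse_reduced_def algebra_simps)
qed

text \<open>The only power of \<open>p\<close> not divisible by \<open>p\<close> is
  \<open>p ^ 0\<close>; its coefficient 1 at \<open>n = 0\<close> is cancelled by the
  \<open>- 1\<close>.\<close>

lemma fps_deriv_artin_hasse_log_nth:
  assumes "\<not> p dvd Suc n"
  shows "fps_nth (fps_deriv (artin_hasse_log p) - 1) n = 0"
proof -
  have "(\<exists>k. Suc n = p ^ k) \<longleftrightarrow> n = 0"
  proof
    assume "\<exists>k. Suc n = p ^ k"
    then obtain k where k: "Suc n = p ^ k" by blast
    with assms have "k = 0" by (cases k) auto
    with k show "n = 0" by simp
  next
    assume "n = 0"
    then have "Suc n = p ^ 0" by simp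
    then show "\<exists>k. Suc n = p ^ k" by blast
  qed
  then show ?thesis
    by (simp add: artin_hasse_log_def del: of_nat_Suc)
qed

text \<open>Strong induction on the differential equation G' = G D. In degree \<open>n - 1\<close>,
  each product pairs indices \<open>i\<close> and \<open>Suc (m - i)\<close> with sum
  \<open>n\<close>, so \<open>p\<close> fails to divide one of them and that factor vanishes. Thus n
  times the coefficient is 0.\<close>

lemma artin_hasse_reduced_nth_eq_0:
  assumes "\<not> p dvd n"
  shows "fps_nth (artin_hasse_reduced p) n = 0"
  using assms
proof (induction n rule: less_induct)
  case (less n)
  let ?G = "artin_hasse_reduced p"
  let ?D = "fps_deriv (artin_hasse_log p) - 1"
  obtain m where m: "n = Suc m"
    using less.prems by (cases n) auto
  have "fps_nth ?G i * fps_nth ?D (m - i) = 0" if "i \<le> m" for i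
  proof (cases "p dvd i")
    case True
    have "n = i + Suc (m - i)" using that m by simp
    with True less.prems have "\<not> p dvd Suc (m - i)"
      by (metis dvd_add)
    then show ?thesis
      using fps_deriv_artin_hasse_log_nth by simp
  next
    case False
    with less.IH[of i] that m show ?thesis by simp
  qed
  then have "fps_nth (?G * ?D) m = 0"
    unfolding fps_mult_nth by (metis (no_types, lifting) atLeastAtMost_iff sum.neutral)
  then have "of_nat n * fps_nth ?G n = 0"
    using fps_deriv_artin_hasse_reduced[of p] m by (metis Suc_eq_plus1 fps_deriv_nth)
  with m show ?case by (simp del: of_nat_Suc)
qed

text \<open>Cauchy product of G and e^x in degree p a - b: only degrees p (a - c) of G survive,
  which leaves degree p c - b for e^x. The conditionals guard against truncated subtraction.\<close>

lemma artin_hasse_coeff_eq_sum: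
  assumes p: "prime p" and a: "a \<le> l" and b: "1 \<le> b"
  shows "artin_hasse_coeff p (int p * int a - int b)
       = (\<Sum>c = 1..l. (if c \<le> a then fps_nth (artin_hasse_reduced p) (p * (a - c)) else 0)
                     * (if b \<le> p * c then 1 / fact (p * c - b) else 0))"
proof (cases "b \<le> p * a")
  case False
  \<comment> \<open>For a negative index the coefficient is 0 by convention, and every summand has a
    false guard.\<close>
  have "\<not> (c \<le> a \<and> b \<le> p * c)" for c
    using False by (meson le_trans mult_le_mono2)
  then have "(if c \<le> a then fps_nth (artin_hasse_reduced p) (p * (a - c)) else 0)
      * (if b \<le> p * c then 1 / fact (p * c - b) else 0) = (0 :: rat)" for c
    by (metis mult_zero_left mult_zero_right)
  moreover have "int p * int a - int b < 0"
    using False by (simp flip: of_nat_mult)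
  ultimately show ?thesis
    by (simp only: artin_hasse_coeff_def if_True sum.neutral_const)
next
  case True
  define N where "N = p * a - b"
  have p0: "p > 0" using p by (rule prime_gt_0_nat)
  have N: "int p * int a - int b = int N"
    using True by (simp add: N_def of_nat_diff)
  define C where "C = {c \<in> {1..l}. c \<le> a \<and> b \<le> p * c}"
  define h where "h = (\<lambda>m. fps_nth (artin_hasse_reduced p) m * (1 / fact (N - m)))"
  have inj: "inj_on (\<lambda>c. p * (a - c)) C"
    using p0 by (auto simp: inj_on_def C_def)
  have img: "(\<lambda>c. p * (a - c)) ` C = {m \<in> {0..N}. p dvd m}"
  proof (intro equalityI subsetI)
    fix m assume "m \<in> (\<lambda>c. p * (a - c)) ` C"
    then show "m \<in> {m \<in> {0..N}. p dvd m}"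
      by (auto simp: C_def N_def diff_mult_distrib2)
  next
    fix m assume "m \<in> {m \<in> {0..N}. p dvd m}"
    then obtain d where d: "m = p * d" "p * d \<le> p * a - b"
      by (auto simp: N_def)
    \<comment> \<open>Strict because \<open>b\<close> is at least 1; hence the preimage
      \<open>a - d\<close> is at least 1 and lies in the summation range.\<close>
    have "p * d < p * a"
      using d(2) b True by linarith
    then have "d < a" by simp
    moreover have "b \<le> p * (a - d)"
      using d(2) True by (simp add: diff_mult_distrib2)
    ultimately have "a - d \<in> C" and "m = p * (a - (a - d))"
      using a d(1) by (auto simp: C_def)
    then show "m \<in> (\<lambda>c. p * (a - c)) ` C" by blast
  qed
  have "artin_hasse_coeff p (int p * int a - int b) = fps_nth (artin_hasse_exp p) N"
    by (simp add: artin_hasse_coeff_def N)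
  also have "\<dots> = (\<Sum>m = 0..N. h m)"
    by (simp add: artin_hasse_exp_eq fps_mult_nth h_def)
  also have "\<dots> = (\<Sum>m \<in> {m \<in> {0..N}. p dvd m}. h m)"
    by (rule sum.mono_neutral_right)
      (auto simp: h_def artin_hasse_reduced_nth_eq_0)
  also have "\<dots> = (\<Sum>c \<in> C. h (p * (a - c)))"
    unfolding img[symmetric] by (simp add: sum.reindex[OF inj])
  also have "\<dots> = (\<Sum>c \<in> C. (if c \<le> a then fps_nth (artin_hasse_reduced p) (p * (a - c)) else 0)
                     * (if b \<le> p * c then 1 / fact (p * c - b) else 0))"
  proof (rule sum.cong)
    fix c assume c: "c \<in> C"
    then have "p * c \<le> p * a" "b \<le> p * c" by (simp_all add: C_def)
    then have "N - p * (a - c) = p * c - b"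
      unfolding N_def diff_mult_distrib2 by linarith
    with c show "h (p * (a - c))
        = (if c \<le> a then fps_nth (artin_hasse_reduced p) (p * (a - c)) else 0)
          * (if b \<le> p * c then 1 / fact (p * c - b) else 0)"
      by (simp add: h_def C_def)
  qed simp
  also have "\<dots> = (\<Sum>c = 1..l. (if c \<le> a then fps_nth (artin_hasse_reduced p) (p * (a - c)) else 0)
                     * (if b \<le> p * c then 1 / fact (p * c - b) else 0))"
    by (rule sum.mono_neutral_left) (auto simp: C_def)
  finally show ?thesis .
qed


section \<open>Triangular factorization\<close>

definition binomial_increment_power :: "nat \<Rightarrow> nat \<Rightarrow> rat fps" where
  "binomial_increment_power p k = ((1 + fps_X) ^ p - 1) ^ k"

lemma fps_one_plus_X_power_nth:
  "fps_nth ((1 + fps_X) ^ n :: 'a :: field_char_0 fps) k = of_nat (n choose k)"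
  by (simp flip: fps_binomial_of_nat add: binomial_gbinomial)

lemma binomial_mult_eq_sum:
  "of_nat (p * c choose b)
     = (\<Sum>k \<le> c. of_nat (c choose k) * fps_nth (binomial_increment_power p k) b)"
proof -
  let ?f = "(1 + fps_X) ^ p - 1 :: rat fps"
  have "(1 + fps_X) ^ (p * c) = (?f + 1) ^ c"
    by (simp add: power_mult)
  also have "\<dots> = (\<Sum>k \<le> c. of_nat (c choose k) * ?f ^ k * 1 ^ (c - k))"
    by (rule binomial_ring)
  finally have "fps_nth ((1 + fps_X) ^ (p * c)) b
      = fps_nth (\<Sum>k \<le> c. of_nat (c choose k) * ?f ^ k) b"
    by simp
  then show ?thesis
    by (simp add: fps_one_plus_X_power_nth fps_sum_nth binomial_increment_power_def
        fps_of_nat[symmetric])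
qed

text \<open>The series (1 + x)^p - 1 starts with p x, so one x can be split off. The order of
  vanishing and the leading coefficient of its powers follow.\<close>

lemma binomial_increment_power_factor:
  obtains h where "binomial_increment_power p k = fps_X ^ k * h ^ k" "fps_nth h 0 = of_nat p"
proof
  let ?f = "(1 + fps_X) ^ p - 1 :: rat fps"
  have "fps_X * fps_shift 1 ?f = ?f"
  proof (rule fps_ext)
    fix n
    show "fps_nth (fps_X * fps_shift 1 ?f) n = fps_nth ?f n"
      by (cases n) (simp_all add: fps_power_zeroth)
  qed
  then show "binomial_increment_power p k = fps_X ^ k * fps_shift 1 ?f ^ k"
    by (metis binomial_increment_power_def power_mult_distrib)
  show "fps_nth (fps_shift 1 ?f) 0 = of_nat p"
    by (simp add: fps_one_plus_X_power_nth)
qed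

lemma binomial_increment_power_nth_less:
  assumes "b < k"
  shows "fps_nth (binomial_increment_power p k) b = 0"
  using assms binomial_increment_power_factor[of p k] by (metis fps_X_power_mult_nth)

lemma binomial_increment_power_nth_self:
  "fps_nth (binomial_increment_power p k) k = of_nat p ^ k"
  using binomial_increment_power_factor[of p k]
  by (metis fps_X_power_mult_nth fps_power_zeroth diff_self_eq_0 less_irrefl)

lemma inverse_fact_mult_diff_eq_sum:
  assumes c: "c \<le> l" and b: "1 \<le> b"
  shows "(if b \<le> p * c then 1 / fact (p * c - b) else 0)
       = (\<Sum>k = 1..l. of_nat (c choose k) / fact (p * c)
                     * (fps_nth (binomial_increment_power p k) b * fact b))"
    (is "?lhs = _")
proof -
  \<comment> \<open>For \<open>b > p * c\<close> the binomial coefficient is 0, which matches the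
    default value.\<close>
  have "?lhs = of_nat (p * c choose b) * fact b / fact (p * c)"
    by (simp add: binomial_fact binomial_eq_0)
  also have "of_nat (p * c choose b)
      = (\<Sum>k \<le> c. of_nat (c choose k) * fps_nth (binomial_increment_power p k) b)"
    by (rule binomial_mult_eq_sum)
  also have "\<dots> = (\<Sum>k = 1..l. of_nat (c choose k) * fps_nth (binomial_increment_power p k) b)"
  \<comment> \<open>The range becomes independent of \<open>c\<close>: the term \<open>k = 0\<close>
    is a positive-degree coefficient of the constant 1, and terms with \<open>k > c\<close> have a
    zero binomial.\<close>
  proof (rule sum.mono_neutral_cong)
    fix k assume "k \<in> {..c} - {1..l}"
    with c have "k = 0" by auto
    with b show "of_nat (c choose k) * fps_nth (binomial_increment_power p k) b = 0"
      by (simp add: binomial_increment_power_def)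
  qed (auto simp: binomial_eq_0)
  also have "\<dots> * fact b / fact (p * c)
      = (\<Sum>k = 1..l. of_nat (c choose k) / fact (p * c)
                     * (fps_nth (binomial_increment_power p k) b * fact b))"
    unfolding sum_distrib_right sum_divide_distrib by (rule sum.cong) simp_all
  finally show ?thesis .
qed

lemma det_artin_hasse:
  assumes p: "prime p"
  shows "det (mat l l (\<lambda>(i, j). artin_hasse_coeff p (int p * int (i + 1) - int (j + 1))))
       = (\<Prod>k = 1..l. fact k * of_nat p ^ k / fact (p * k))"
proof -
  let ?G = "artin_hasse_reduced p"
  \<comment> \<open>Matrix indices start at 0, hence the \<open>Suc\<close> in \<open>B\<close> and
    \<open>C\<close>; in \<open>T\<close> only the difference of indices enters, so the shift
    cancels.\<close>
  define T where "T = mat l l (\<lambda>(i, j). if j \<le> i then fps_nth ?G (p * (i - j)) else 0)"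
  define B :: "rat mat" where
    "B = mat l l (\<lambda>(i, j). of_nat (Suc i choose Suc j) / fact (p * Suc i))"
  define C where
    "C = mat l l (\<lambda>(i, j). fps_nth (binomial_increment_power p (Suc i)) (Suc j) * fact (Suc j))"
  have carrier: "T \<in> carrier_mat l l" "B \<in> carrier_mat l l" "C \<in> carrier_mat l l"
    by (simp_all add: T_def B_def C_def)
  have BC: "(B * C) $$ (i, j)
      = (if Suc j \<le> p * Suc i then 1 / fact (p * Suc i - Suc j) else 0)"
    if "i < l" "j < l" for i j
  proof -
    have "(B * C) $$ (i, j)
        = (\<Sum>k = 0..<l. of_nat (Suc i choose Suc k) / fact (p * Suc i)
              * (fps_nth (binomial_increment_power p (Suc k)) (Suc j) * fact (Suc j)))"
      using that by (simp add: B_def C_def scalar_prod_def del: fact_Suc mult_Suc_right)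
    also have "\<dots> = (\<Sum>k = 1..l. of_nat (Suc i choose k) / fact (p * Suc i)
              * (fps_nth (binomial_increment_power p k) (Suc j) * fact (Suc j)))"
      by (rule sum.reindex_bij_witness[of _ "\<lambda>k. k - 1" Suc])  auto
    finally show ?thesis
      using inverse_fact_mult_diff_eq_sum[of "Suc i" l "Suc j" p] that by simp
  qed
  have "mat l l (\<lambda>(i, j). artin_hasse_coeff p (int p * int (i + 1) - int (j + 1))) = T * (B * C)"
    (is "?M = _")
  proof (rule eq_matI)
    fix i j assume "i < dim_row (T * (B * C))" "j < dim_col (T * (B * C))"
    then have ij: "i < l" "j < l" using carrier by auto
    have "(T * (B * C)) $$ (i, j) = (\<Sum>c = 0..<l. T $$ (i, c) * (B * C) $$ (c, j))"
      using ij carrier by (simp add: scalar_prod_def)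
    also have "\<dots> = (\<Sum>c = 0..<l.
        (if Suc c \<le> Suc i then fps_nth ?G (p * (Suc i - Suc c)) else 0)
        * (if Suc j \<le> p * Suc c then 1 / fact (p * Suc c - Suc j) else 0))"
      using ij by (intro sum.cong) (simp_all add: BC T_def)
    also have "\<dots> = (\<Sum>c = 1..l. (if c \<le> Suc i then fps_nth ?G (p * (Suc i - c)) else 0)
        * (if Suc j \<le> p * c then 1 / fact (p * c - Suc j) else 0))"
      by (rule sum.reindex_bij_witness[of _ "\<lambda>k. k - 1" Suc]) auto
    also have "\<dots> = ?M $$ (i, j)"
      using artin_hasse_coeff_eq_sum[OF p, of "Suc i" l "Suc j"] ij by simp
    finally show "?M $$ (i, j) = (T * (B * C)) $$ (i, j)" by simp
  qed (use carrier in auto)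
  then have "det ?M = det T * (det B * det C)"
    using carrier by (simp add: det_mult[of _ l])
  also have "det T = 1"
    by (subst det_lower_triangular[OF _ carrier(1)])
      (simp_all add: T_def prod_list_diag_prod artin_hasse_reduced_nth_0)
  also have "det B = (\<Prod>k = 0..<l. 1 / fact (p * Suc k))"
    by (subst det_lower_triangular[OF _ carrier(2)])
      (simp_all add: B_def prod_list_diag_prod binomial_eq_0)
  also have "det C = (\<Prod>k = 0..<l. of_nat p ^ Suc k * fact (Suc k))"
    by (subst det_upper_triangular[OF _ carrier(3)])
      (auto simp: C_def prod_list_diag_prod upper_triangular_def binomial_increment_power_nth_less
        binomial_increment_power_nth_self simp del: fact_Suc power_Suc)
  also have "1 * ((\<Prod>k = 0..<l. 1 / fact (p * Suc k))
      * (\<Prod>k = 0..<l. of_nat p ^ Suc k * fact (Suc k)))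
      = (\<Prod>k = 0..<l. fact (Suc k) * of_nat p ^ Suc k / fact (p * Suc k) :: rat)"
    unfolding mult_1_left prod.distrib[symmetric]
    by (rule prod.cong) (simp_all del: fact_Suc power_Suc mult_Suc_right)
  also have "\<dots> = (\<Prod>k = 1..l. fact k * of_nat p ^ k / fact (p * k))"
    by (rule prod.reindex_bij_witness[of _ "\<lambda>k. k - 1" Suc]) auto
  finally show ?thesis .
qed


section \<open>Units\<close>

text \<open>The multiples of \<open>p\<close> up to \<open>p * k\<close> are p, 2p, ..., kp, with
  product k! p^k.\<close>

lemma fact_mult_prime_eq:
  assumes "prime p"
  shows "fact (p * k) = fact k * p ^ k * \<Prod>{j \<in> {1..p * k}. \<not> p dvd j}"
proof -
  have p0: "p > 0" using assms by (rule prime_gt_0_nat)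
  have dvd: "{j \<in> {1..p * k}. p dvd j} = (*) p ` {1..k}"
    using p0 by (auto simp: image_iff elim!: dvdE)
  have "fact (p * k) = \<Prod>{1..p * k}"
    by (simp add: fact_prod)
  also have "{1..p * k} = {j \<in> {1..p * k}. p dvd j} \<union> {j \<in> {1..p * k}. \<not> p dvd j}"
    by auto
  also have "\<Prod>\<dots> = \<Prod>{j \<in> {1..p * k}. p dvd j} * \<Prod>{j \<in> {1..p * k}. \<not> p dvd j}"
    by (rule prod.union_disjoint) auto
  also have "\<Prod>{j \<in> {1..p * k}. p dvd j} = (\<Prod>i = 1..k. p * i)"
    unfolding dvd using p0 by (subst prod.reindex) (auto simp: inj_on_def)
  also have "\<dots> = fact k * p ^ k"
    by (simp add: prod.distrib fact_prod)
  finally show ?thesis .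
qed

lemma inverse_of_int_mem_padic_unit_rats:
  assumes p: "prime p" and N: "N > 0" "coprime N (int p)"
  shows "1 / of_int N \<in> padic_unit_rats p"
proof -
  \<comment> \<open>The inverse of \<open>N\<close> is built level by level; the outer
    \<open>mod\<close> selects the representative that \<open>padic_ring\<close> demands.\<close>
  define y where "y n = modular_inverse (int p ^ n) N mod int p ^ n" for n
  have p0: "int p ^ n > 0" for n using p prime_gt_0_nat by simp
  have Ny: "[N * y n = 1] (mod int p ^ n)" for n
  proof -
    have "coprime N (int p ^ n)" using N(2) by simp
    then have "[N * modular_inverse (int p ^ n) N = 1] (mod int p ^ n)"
      by (metis cong_modular_inverse1)
    then show ?thesis
      by (simp add: y_def cong_def mod_mult_right_eq)
  qed
  have "y (Suc n) mod int p ^ n = y n" for n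
  proof -
    \<comment> \<open>Coherence holds because inverses modulo \<open>p ^ n\<close> are unique: both
      entries invert \<open>N\<close>, which can be cancelled.\<close>
    have "[N * y (Suc n) = 1] (mod int p ^ n)"
      using Ny[of "Suc n"] by (rule cong_dvd_modulus) simp
    then have "[N * y (Suc n) = N * y n] (mod int p ^ n)"
      using Ny cong_sym cong_trans by blast
    then have "[y (Suc n) = y n] (mod int p ^ n)"
      using N(2) by (simp add: cong_mult_lcancel)
    then show ?thesis by (simp add: cong_def y_def)
  qed
  then have y: "y \<in> carrier (padic_ring p)"
    using p0 by (simp add: padic_ring_def y_def)
  have N_mem: "padic_of_int p N \<in> carrier (padic_ring p)"
    using p0 by (simp add: padic_ring_def padic_of_int_def mod_mod_cancel)
  have mult: "padic_of_int p N \<otimes>\<^bsub>padic_ring p\<^esub> y = \<one>\<^bsub>padic_ring p\<^esub>"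
    using Ny by (simp add: padic_ring_def padic_of_int_def cong_def mod_simps)
  interpret cring "padic_ring p" using p by (rule cring_padic_ring)
  have "y \<in> Units (padic_ring p)"
    using y N_mem mult m_comm[OF y N_mem] by (auto simp: Units_def)
  \<comment> \<open>The fraction is already normalized, so \<open>rat_eq_padic\<close> amounts to
    the equation N y = 1.\<close>
  moreover have "quotient_of (Rat.Fract 1 N) = (1, N)"
    using N(1) by (simp add: quotient_of_Fract Rat.normalize_def)
  then have "quotient_of (1 / of_int N) = (1, N)"
    by (simp add: Fract_of_int_quotient)
  then have "rat_eq_padic p (1 / of_int N) y"
    using y mult by (simp add: rat_eq_padic_def padic_of_int_def padic_ring_def)
  ultimately show ?thesis
    by (auto simp: padic_unit_rats_def)
qed

text \<open>Each factor is the reciprocal of a product of numbers prime to \<open>p\<close>, so the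
  whole product is 1 / N for a positive integer N prime to \<open>p\<close>.\<close>

lemma prod_fact_quotient_mem_padic_unit_rats:
  assumes p: "prime p"
  shows "(\<Prod>k = 1..l. fact k * of_nat p ^ k / fact (p * k)) \<in> padic_unit_rats p"
proof -
  define P where "P k = \<Prod>{j \<in> {1..p * k}. \<not> p dvd j}" for k
  define N where "N = (\<Prod>k = 1..l. P k)"
  have pos: "P k > 0" for k
    by (auto simp: P_def intro!: prod_pos)
  have cop: "coprime (P k) p" for k
    unfolding P_def using p
    by (intro prod_coprime_left) (auto simp: coprime_commute[of _ p] prime_imp_coprime)
  have quot: "fact k * of_nat p ^ k / fact (p * k) = (1 / of_nat (P k) :: rat)" for k
  proof -
    have "(fact (p * k) :: rat) = of_nat (fact (p * k))" by simp
    also have "\<dots> = fact k * of_nat p ^ k * of_nat (P k)"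
      by (simp only: fact_mult_prime_eq[OF p] P_def of_nat_mult of_nat_power of_nat_fact)
    finally show ?thesis
      using pos[of k] p prime_gt_0_nat[OF p] by (simp add: field_simps)
  qed
  have "N > 0" using pos by (auto simp: N_def intro!: prod_pos)
  moreover have "coprime N p" using cop by (auto simp: N_def intro!: prod_coprime_left)
  ultimately have "1 / rat_of_int (int N) \<in> padic_unit_rats p"
    using p by (intro inverse_of_int_mem_padic_unit_rats) (simp_all add: coprime_int_iff)
  then show ?thesis
    by (simp only: quot) (simp add: N_def prod_dividef)
qed

theorem theorem1p1:
  fixes p l :: nat
  assumes "prime p" and "l \<ge> 1"
  shows "det (mat l l (\<lambda>(i, j). artin_hasse_coeff p (int p * int (i + 1) - int (j + 1))))
           = (\<Prod>k = 1..l. fact k * of_nat p ^ k / fact (p * k))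
       \<and> det (mat l l (\<lambda>(i, j). artin_hasse_coeff p (int p * int (i + 1) - int (j + 1))))
           \<in> padic_unit_rats p"
  using det_artin_hasse[OF assms(1)] prod_fact_quotient_mem_padic_unit_rats[OF assms(1)]
  by simp

end
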